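(* Let $t>0$ and let $T_1<\cdots<T_{N(t)}$ be the observed event times in $[0,t]$, with $N(t)\ge1$. Consider the parametric exponential Hawkes model with parameter $\theta=(\bar\lambda_0,\bar\alpha,\bar\beta)\in\Theta=(0,\infty)\times\mathbb{R}\times(0,\infty)$, with candidate intensity $\lambda_\theta$, underlying intensity function $\lambda_\theta^\star$, restart times $T_{\theta,1}^\star,\dots,T_{\theta,N(t)}^\star$, compensator $\Lambda_\theta$ and log-likelihood $\ell_t(\theta)$. For any $\theta=(\bar\lambda_0,\bar\alpha,\bar\beta)\in\Theta$, denoting for $k\in\{2,\dots,N(t)\}$ $$ \Lambda_{\theta,k}=\bar\lambda_0\,(T_k-T_{\theta,k-1}^\star)+\bar\beta^{-1}\big(\lambda_\theta^\star(T_{k-1})-\bar\lambda_0\big)\Big(\mathrm{e}^{-\bar\beta(T_{\theta,k-1}^\star-T_{k-1})}-\mathrm{e}^{-\bar\beta(T_k-T_{k-1})}\Big), $$ the log-likelihood reads (with the convention $\log(x)=-\infty$ for $x\le0$) $$ \begin{aligned} \ell_t(\theta)={}&\log\bar\lambda_0-\bar\lambda_0T_1+\sum_{k=2}^{N(t)}\Big[\log\Big(\bar\lambda_0+\big(\lambda_\theta^\star(T_{k-1})-\bar\lambda_0\big)\mathrm{e}^{-\bar\beta(T_k-T_{k-1})}\Big)-\Lambda_{\theta,k}\Big]\\ &-\Big[\bar\lambda_0\,(t-T_{\theta,N(t)}^\star)+\bar\beta^{-1}\big(\lambda_\theta^\star(T_{N(t)})-\bar\lambda_0\big)\Big(\mathrm{e}^{-\bar\beta(T_{\theta,N(t)}^\star-T_{N(t)})}-\mathrm{e}^{-\bar\beta(t-T_{N(t)})}\Big)\Big]\mathbf{1}_{t>T_{\theta,N(t)}^\star}.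 \end{aligned} $$
   Context: The observations are event times $0<T_1<\cdots<T_{N(t)}\le t$ in the time interval $[0,t]$, where $N(t)$ is their number. For real $x$, $x^+=\max(0,x)$. For $\theta=(\bar\lambda_0,\bar\alpha,\bar\beta)\in\Theta$ and $s\ge0$, the underlying intensity function is $$\lambda_\theta^\star(s)=\bar\lambda_0+\sum_{k\le N(t),\,T_k\le s}\bar\alpha\,\mathrm{e}^{-\bar\beta(s-T_k)},$$ and the candidate conditional intensity is $\lambda_\theta(s)=(\lambda_\theta^\star(s))^+$. The candidate compensator is $\Lambda_\theta(s)=\int_0^s\lambda_\theta(u)\,\mathrm{d}u$. The restart times are $T_{\theta,k}^\star=\inf\{s\ge T_k:\lambda_\theta(s)>0\}$ for $k\in\{1,\dots,N(t)\}$. The log-likelihood of $\theta$ with respect to the observations $T_1,\dots,T_{N(t)}$ in $[0,t]$ is $$\ell_t(\theta)=\sum_{k=1}^{N(t)}\log\big(\lambda_\theta(T_k^-)\big)-\Lambda_\theta(t),\qquad \lambda_\theta(T_k^-)=\lim_{s\uparrow T_k}\lambda_\theta(s),$$ with the convention $\log(x)=-\infty$ for $x\le0$ (so $\ell_t(\theta)\in[-\infty,\infty)$). *)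

theory Defs
  imports "HOL-Analysis.Analysis"
begin

text \<open>
  The observations are given by their number \<open>n\<close> (standing for $N(t)$) and a sequence
  \<open>T\<close>, of which only the values \<open>T 1, \<dots>, T n\<close> are ever used. The parameter
  $\theta = (\bar\lambda_0, \bar\alpha, \bar\beta)$ is passed as three real arguments \<open>l0 a b\<close>.
\<close>

definition hawkes_params :: "(real \<times> real \<times> real) set" where
  "hawkes_params = {0<..} \<times> UNIV \<times> {0<..}"

definition underlying_intensity ::
    "nat \<Rightarrow> (nat \<Rightarrow> real) \<Rightarrow> real \<Rightarrow> real \<Rightarrow> real \<Rightarrow> real \<Rightarrow> real" where
  "underlying_intensity n T l0 a b s =
     l0 + (\<Sum>k | k \<in> {1..n} \<and> T k \<le> s. a * exp (- b * (s - T k)))"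

definition intensity ::
    "nat \<Rightarrow> (nat \<Rightarrow> real) \<Rightarrow> real \<Rightarrow> real \<Rightarrow> real \<Rightarrow> real \<Rightarrow> real" where
  "intensity n T l0 a b s = max 0 (underlying_intensity n T l0 a b s)"

definition compensator ::
    "nat \<Rightarrow> (nat \<Rightarrow> real) \<Rightarrow> real \<Rightarrow> real \<Rightarrow> real \<Rightarrow> real \<Rightarrow> real" where
  "compensator n T l0 a b s = integral {0..s} (intensity n T l0 a b)"

text \<open>
  The infimum is taken in the reals: for parameters in \<^const>\<open>hawkes_params\<close> the set is
  bounded below by \<open>T k\<close>, and nonempty because the underlying intensity tends to
  \<open>l0 > 0\<close> at infinity.
\<close>

definition restart_time ::
    "nat \<Rightarrow> (nat \<Rightarrow> real) \<Rightarrow> real \<Rightarrow> real \<Rightarrow> real \<Rightarrow> nat \<Rightarrow> real" where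
  "restart_time n T l0 a b k = Inf {s. T k \<le> s \<and> intensity n T l0 a b s > 0}"

definition elog :: "real \<Rightarrow> ereal" where
  "elog x = (if x \<le> 0 then -\<infinity> else ereal (ln x))"

definition log_likelihood ::
    "nat \<Rightarrow> (nat \<Rightarrow> real) \<Rightarrow> real \<Rightarrow> real \<Rightarrow> real \<Rightarrow> real \<Rightarrow> ereal" where
  "log_likelihood n T l0 a b t =
     (\<Sum>k=1..n. elog (Lim (at_left (T k)) (intensity n T l0 a b)))
     - ereal (compensator n T l0 a b t)"

text \<open>
  The quantity $\Lambda_{\theta,k}$, for \<open>k \<ge> 2\<close>. It is the closed form from the source
  for every \<open>k\<close>, including when the restart time lies beyond \<open>T k\<close>, where it need not
  be the increment of the compensator over $[T_{k-1}, T_k]$.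
\<close>

definition compensator_term ::
    "nat \<Rightarrow> (nat \<Rightarrow> real) \<Rightarrow> real \<Rightarrow> real \<Rightarrow> real \<Rightarrow> nat \<Rightarrow> real" where
  "compensator_term n T l0 a b k =
     l0 * (T k - restart_time n T l0 a b (k - 1))
     + inverse b * (underlying_intensity n T l0 a b (T (k - 1)) - l0)
       * (exp (- b * (restart_time n T l0 a b (k - 1) - T (k - 1)))
          - exp (- b * (T k - T (k - 1))))"

end

theory Submission
  imports Defs
begin

text \<open>
  Between two consecutive events the underlying intensity receives no new jump: every summand
  decays at the same rate \<open>b\<close>, so the whole history enters only through the value at
  the last event, and the curve relaxes exponentially from that value to the baseline \<open>l0\<close>
  (\<open>underlying_intensity_eq_relax\<close>). This already gives the left limits at the events.

  Such a curve is monotone with positive limit \<open>l0\<close>, so its sign is governed by a single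
  threshold: after the event it is positive exactly beyond some time \<open>r\<close>, which is the event
  time itself if the curve starts positive (\<open>exp_relaxation_sign_change\<close>). If \<open>r\<close> lies
  before the next event, or if there is no further event, then \<open>r\<close> is the restart time;
  the intensity vanishes between the event and \<open>r\<close> and equals the curve afterwards, so
  integrating an exponential gives the increment of the compensator.

  The threshold lies before the next event precisely when the curve is positive at that event, that
  is, when the intensity has a positive left limit there.
  If all these limits are positive, summing the increments and adding the last one up to \<open>t\<close>
  proves the formula as an identity of reals. If one of them is not positive, the closed form of the
  compensator may fail, but then each side contains a logarithm equal to \<open>-\<infinity>\<close> and no
  term equal to \<open>\<infinity>\<close>, so both sides are \<open>-\<infinity>\<close>.
\<close>

section \<open>Extended-real sums and logarithms\<close>

lemma elog_max_0: "elog (max 0 x) = elog x"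
  by (auto simp: elog_def max_def)

lemma elog_neq_PInf [simp]: "elog x \<noteq> \<infinity>"
  by (simp add: elog_def)

lemma sum_ereal_MInf:
  fixes f :: "'i \<Rightarrow> ereal"
  assumes "finite A" "\<And>i. i \<in> A \<Longrightarrow> f i \<noteq> \<infinity>" "i \<in> A" "f i = -\<infinity>"
  shows "sum f A = -\<infinity>"
proof -
  have "sum f (A - {i}) \<noteq> \<infinity>"
    using assms by (auto simp: sum_Pinfty)
  then show ?thesis
    using assms by (simp add: sum.remove[of A i])
qed

section \<open>Exponential relaxation to a positive level\<close>

text \<open>
  The equivalence cannot extend to \<open>s = u\<close>: a curve that starts positive has
  \<open>r = u\<close>, and so does one that starts at zero and becomes positive immediately afterwards.
  The disjunction supplies what is needed at \<open>u\<close>: a curve whose threshold lies strictly later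
  does not start positive.
\<close>
lemma exp_relaxation_sign_change:
  fixes l0 b c u :: real
  assumes "l0 > 0" "b > 0"
  obtains r where "u \<le> r" "r = u \<or> l0 + c \<le> 0"
    "\<And>s. u < s \<Longrightarrow> 0 < l0 + c * exp (- b * (s - u)) \<longleftrightarrow> r < s"
proof (cases "l0 + c \<ge> 0")
  case True
  have "0 < l0 + c * exp (- b * (s - u))" if "u < s" for s
  proof -
    have e: "exp (- b * (s - u)) < 1"
      using that assms by simp
    \<comment> \<open>the curve is a convex combination of the limit \<open>l0\<close> and the initial value\<close>
    have "0 < l0 * (1 - exp (- b * (s - u)))"
      using e assms by simp
    also have "\<dots> \<le> l0 * (1 - exp (- b * (s - u))) + (l0 + c) * exp (- b * (s - u))"
      using True by simp
    finally show ?thesis by (simp add: algebra_simps)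
  qed
  then show ?thesis
    by (intro that[of u]) auto
next
  case False
  \<comment> \<open>the zero of the curve\<close>
  define r where "r = u + ln (- c / l0) / b"
  have q: "- c / l0 > 1"
    using False assms by (simp add: field_simps)
  have "0 < l0 + c * exp (- b * (s - u)) \<longleftrightarrow> r < s" for s
  proof -
    have "0 < l0 + c * exp (- b * (s - u)) \<longleftrightarrow> - c / l0 < exp (b * (s - u))"
    proof -
      have "exp (- b * (s - u)) = inverse (exp (b * (s - u)))"
        by (simp add: exp_minus [symmetric])
      then show ?thesis
        using assms(1) exp_gt_zero[of "b * (s - u)"] by (simp only:) (simp add: field_simps, linarith)
    qed
    also have "\<dots> \<longleftrightarrow> ln (- c / l0) < b * (s - u)"
      using q by (metis exp_less_cancel_iff exp_ln less_trans zero_less_one)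
    also have "\<dots> \<longleftrightarrow> r < s"
      using assms by (simp add: r_def field_simps)
    finally show ?thesis .
  qed
  moreover have "u \<le> r"
    using q assms by (simp add: r_def)
  ultimately show ?thesis
    using False by (intro that[of r]) auto
qed

lemma has_integral_exp_relaxation:
  fixes l0 b c u r v :: real
  assumes "b > 0" "r \<le> v"
  shows "((\<lambda>s. l0 + c * exp (- b * (s - u))) has_integral
      l0 * (v - r) + inverse b * c * (exp (- b * (r - u)) - exp (- b * (v - u)))) {r..v}"
proof -
  define F where "F = (\<lambda>s. l0 * s - inverse b * c * exp (- b * (s - u)))"
  have "((\<lambda>s. l0 + c * exp (- b * (s - u))) has_integral F v - F r) {r..v}"
  proof (rule fundamental_theorem_of_calculus[OF assms(2)])
    fix s assume "s \<in> {r..v}"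
    show "(F has_vector_derivative l0 + c * exp (- b * (s - u))) (at s within {r..v})"
      unfolding F_def has_real_derivative_iff_has_vector_derivative [symmetric]
      using assms(1) by (auto intro!: derivative_eq_intros simp: field_simps)
  qed
  then show ?thesis
    by (simp add: F_def algebra_simps)
qed

text \<open>
  The positive part contributes only after the sign change, and the indicator covers an interval
  that ends at or before it.
\<close>
lemma has_integral_pos_part_exp_relaxation:
  fixes l0 b c u r v :: real
  assumes "b > 0" "u \<le> r" "u \<le> v"
    and sign: "\<And>s. u < s \<Longrightarrow> 0 < l0 + c * exp (- b * (s - u)) \<longleftrightarrow> r < s"
  shows "((\<lambda>s. max 0 (l0 + c * exp (- b * (s - u)))) has_integral
      (l0 * (v - r) + inverse b * c * (exp (- b * (r - u)) - exp (- b * (v - u))))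
        * indicator {r<..} v) {u..v}"
proof -
  let ?g = "\<lambda>s. l0 + c * exp (- b * (s - u))"
  have vanish: "((\<lambda>s. max 0 (?g s)) has_integral 0) {u..w}" if "w \<le> r" for w
  proof (rule has_integral_spike_finite[of "{u}" _ _ "\<lambda>_. 0"])
    fix s assume "s \<in> {u..w} - {u}"
    with that sign[of s] show "max 0 (?g s) = 0" by auto
  qed auto
  show ?thesis
  proof (cases "r < v")
    case True
    have "((\<lambda>s. max 0 (?g s)) has_integral
        l0 * (v - r) + inverse b * c * (exp (- b * (r - u)) - exp (- b * (v - u)))) {r..v}"
    proof (rule has_integral_spike_finite[OF _ _ has_integral_exp_relaxation[OF assms(1)]])
      fix s assume "s \<in> {r..v} - {r}"
      with assms sign[of s] show "max 0 (?g s) = ?g s" by auto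
    qed (use True in auto)
    from has_integral_combine[OF assms(2) _ vanish[OF order_refl] this] True
    show ?thesis by simp
  next
    case False
    then show ?thesis using vanish[of v] by simp
  qed
qed

section \<open>The intensity between consecutive events\<close>

locale hawkes_sample =
  fixes n :: nat and T :: "nat \<Rightarrow> real" and l0 a b :: real
  assumes T_strict_mono: "strict_mono_on {1..n} T"
    and T_pos: "k \<in> {1..n} \<Longrightarrow> 0 < T k"
    and l0_pos: "0 < l0" and b_pos: "0 < b"
begin

abbreviation "ustar \<equiv> underlying_intensity n T l0 a b"
abbreviation "lam \<equiv> intensity n T l0 a b"
abbreviation "restart \<equiv> restart_time n T l0 a b"

text \<open>
  The curve that the underlying intensity would follow from the \<open>k\<close>-th event on if no
  further event occurred.
\<close>
definition relax :: "nat \<Rightarrow> real \<Rightarrow> real" where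
  "relax k s = l0 + (ustar (T k) - l0) * exp (- b * (s - T k))"

lemma T_less_iff: "i \<in> {1..n} \<Longrightarrow> j \<in> {1..n} \<Longrightarrow> T i < T j \<longleftrightarrow> i < j"
  using T_strict_mono by (metis strict_mono_on_less)

lemma events_up_to:
  assumes "k \<in> {1..n}" "T k \<le> s" "k < n \<Longrightarrow> s < T (Suc k)"
  shows "{i. i \<in> {1..n} \<and> T i \<le> s} = {1..k}"
proof (intro set_eqI iffI)
  fix i assume i: "i \<in> {i. i \<in> {1..n} \<and> T i \<le> s}"
  show "i \<in> {1..k}"
  proof (rule ccontr)
    assume "i \<notin> {1..k}"
    with i have "Suc k \<le> i" "k < n" "i \<in> {1..n}" by auto
    then have "T (Suc k) \<le> T i"
      using T_less_iff[of i "Suc k"] assms(1) by auto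
    with assms(3) \<open>k < n\<close> i show False by auto
  qed
next
  fix i assume "i \<in> {1..k}"
  with assms T_less_iff[of k i] show "i \<in> {i. i \<in> {1..n} \<and> T i \<le> s}"
    by auto
qed

text \<open>
  All exponentials share the rate \<open>b\<close>, so a common factor
  \<open>exp (- b * (s - T k))\<close> comes out of the sum over the past events.
\<close>
lemma underlying_intensity_eq_relax:
  assumes "k \<in> {1..n}" "T k \<le> s" "k < n \<Longrightarrow> s < T (Suc k)"
  shows "ustar s = relax k s"
proof -
  have "{i. i \<in> {1..n} \<and> T i \<le> T k} = {1..k}"
    by (rule events_up_to) (use assms T_less_iff[of k "Suc k"] in auto)
  then have "relax k s = l0 + (\<Sum>i\<in>{1..k}. a * exp (- b * (T k - T i))) * exp (- b * (s - T k))"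
    by (simp add: relax_def underlying_intensity_def)
  also have "\<dots> = l0 + (\<Sum>i\<in>{1..k}. a * exp (- b * (s - T i)))"
  proof -
    have "a * exp (- b * (T k - T i)) * exp (- b * (s - T k)) = a * exp (- b * (s - T i))" for i
      unfolding mult.assoc exp_add [symmetric] by (simp add: algebra_simps)
    then show ?thesis by (simp only: sum_distrib_right)
  qed
  finally show ?thesis
    using events_up_to[OF assms] by (simp add: underlying_intensity_def)
qed

lemma intensity_before_first:
  assumes "n \<ge> 1" "s < T 1"
  shows "lam s = l0"
proof -
  have "{i. i \<in> {1..n} \<and> T i \<le> s} = {}"
    using T_less_iff[of _ 1] assms by force
  then show ?thesis
    using l0_pos unfolding intensity_def underlying_intensity_def by (simp only: sum.empty)
qed

lemma left_limit_first:
  assumes "n \<ge> 1"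
  shows "Lim (at_left (T 1)) lam = l0"
proof (rule tendsto_Lim)
  have "eventually (\<lambda>s. lam s = l0) (at_left (T 1))"
    using intensity_before_first[OF assms] by (auto simp: eventually_at_filter)
  then show "(lam \<longlongrightarrow> l0) (at_left (T 1))"
    by (rule tendsto_eventually)
qed simp

lemma left_limit_next:
  assumes "k \<in> {1..<n}"
  shows "Lim (at_left (T (Suc k))) lam = max 0 (relax k (T (Suc k)))"
proof (rule tendsto_Lim)
  have "isCont (\<lambda>s. max 0 (relax k s)) (T (Suc k))"
    unfolding relax_def by (intro continuous_intros)
  then have "((\<lambda>s. max 0 (relax k s)) \<longlongrightarrow> max 0 (relax k (T (Suc k)))) (at_left (T (Suc k)))"
    unfolding isCont_def by (rule tendsto_mono[OF at_le, rotated]) simp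
  moreover have "eventually (\<lambda>s. max 0 (relax k s) = lam s) (at_left (T (Suc k)))"
    unfolding eventually_at_left_field
    using assms T_less_iff[of k "Suc k"]
    by (intro exI[of _ "T k"]) (auto simp: intensity_def underlying_intensity_eq_relax[of k])
  ultimately show "(lam \<longlongrightarrow> max 0 (relax k (T (Suc k)))) (at_left (T (Suc k)))"
    by (rule Lim_transform_eventually)
qed simp

section \<open>Restart times and the compensator\<close>

text \<open>
  On a right neighbourhood of \<open>r\<close> the intensity is still governed by the curve, which is
  positive there; later events can only change the intensity beyond that neighbourhood and so do not
  affect the infimum. This is where \<open>next_event\<close> matters: a jump at or before the sign
  change could restart the intensity earlier or postpone the restart.
\<close>
lemma restart_time_eqI:
  assumes "k \<in> {1..n}" "T k \<le> r" "r = T k \<or> relax k (T k) \<le> 0"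
    and sign: "\<And>s. T k < s \<Longrightarrow> 0 < relax k s \<longleftrightarrow> r < s"
    and next_event: "k < n \<Longrightarrow> r < T (Suc k)"
  shows "restart k = r"
proof -
  let ?S = "{s. T k \<le> s \<and> lam s > 0}"
  have pos: "0 < lam s \<longleftrightarrow> 0 < relax k s" if "T k \<le> s" "k < n \<Longrightarrow> s < T (Suc k)" for s
    using underlying_intensity_eq_relax[OF assms(1) that] by (simp add: intensity_def less_max_iff_disj)
  have lower: "r \<le> s" if "s \<in> ?S" for s
  proof (rule ccontr)
    assume "\<not> r \<le> s"
    with that have s: "T k \<le> s" "s < r" "0 < lam s" by auto
    then have "0 < relax k s" using pos[of s] next_event by force
    with s assms(3) sign[of s] show False by (cases "s = T k") auto
  qed
  obtain v where v: "r < v" "k < n \<Longrightarrow> v \<le> T (Suc k)"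
    using next_event by (metis gt_ex order_refl)
  have mem: "s \<in> ?S" if "r < s" "s < v" for s
    using that v(2) assms(2) pos[of s] sign[of s] by force
  have upper: "Inf ?S \<le> s" if "r < s" "s < v" for s
  proof (rule cInf_lower)
    show "s \<in> ?S" using that by (rule mem)
    show "bdd_below ?S" by (rule bdd_belowI[of _ "T k"]) auto
  qed
  have "Inf ?S \<le> r"
    using dense_ge_bounded[OF v(1), of "Inf ?S"] upper by blast
  moreover have "?S \<noteq> {}"
    using mem dense[OF v(1)] by blast
  then have "r \<le> Inf ?S" by (rule cInf_greatest) (rule lower)
  ultimately show ?thesis by (simp add: restart_time_def)
qed

text \<open>
  One statement serves both kinds of intervals: up to the next event, where positivity of the curve
  at that event makes the indicator equal to 1, and up to an arbitrary horizon after the last event.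
\<close>
lemma has_integral_intensity_after:
  assumes k: "k \<in> {1..n}" and v: "T k \<le> v" "k < n \<Longrightarrow> v = T (Suc k) \<and> 0 < relax k v"
  shows "(lam has_integral
      (l0 * (v - restart k) + inverse b * (ustar (T k) - l0)
        * (exp (- b * (restart k - T k)) - exp (- b * (v - T k)))) * indicator {restart k<..} v)
      {T k..v}"
    and "k < n \<Longrightarrow> restart k < v"
proof -
  obtain r where r: "T k \<le> r" "r = T k \<or> l0 + (ustar (T k) - l0) \<le> 0"
    and sign: "\<And>s. T k < s \<Longrightarrow>
      0 < l0 + (ustar (T k) - l0) * exp (- b * (s - T k)) \<longleftrightarrow> r < s"
    using exp_relaxation_sign_change[OF l0_pos b_pos] by metis
  have rv: "r < v" if "k < n"
    using v(2)[OF that] sign[of v] T_less_iff[of k "Suc k"] k that by (auto simp: relax_def)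
  have restart: "restart k = r"
  proof (rule restart_time_eqI[OF k])
    show "r < T (Suc k)" if "k < n" using rv v(2) that by auto
  qed (use r sign in \<open>auto simp: relax_def\<close>)
  show "restart k < v" if "k < n" using rv that restart by simp
  show "(lam has_integral
      (l0 * (v - restart k) + inverse b * (ustar (T k) - l0)
        * (exp (- b * (restart k - T k)) - exp (- b * (v - T k)))) * indicator {restart k<..} v)
      {T k..v}"
    unfolding restart
  proof (rule has_integral_spike_finite[OF _ _
        has_integral_pos_part_exp_relaxation[OF b_pos r(1) v(1) sign]])
    \<comment> \<open>the curve misses the jump at the next event, hence the right endpoint is excluded\<close>
    fix s assume s: "s \<in> {T k..v} - {v}"
    with k v(2) have "ustar s = relax k s"
      by (intro underlying_intensity_eq_relax) auto
    then show "lam s = max 0 (l0 + (ustar (T k) - l0) * exp (- b * (s - T k)))"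
      by (simp add: intensity_def relax_def)
  qed auto
qed

lemma has_integral_intensity_upto_event:
  assumes "m \<in> {1..n}" "\<And>k. k \<in> {1..<m} \<Longrightarrow> 0 < relax k (T (Suc k))"
  shows "(lam has_integral l0 * T 1 + (\<Sum>k=2..m. compensator_term n T l0 a b k)) {0..T m}"
  using assms
proof (induction m)
  case 0
  then show ?case by simp
next
  case (Suc m)
  show ?case
  proof (cases "m = 0")
    case True
    have "(lam has_integral l0 * T 1) {0..T 1}"
    proof (rule has_integral_spike_finite[of "{T 1}"])
      show "((\<lambda>_. l0) has_integral l0 * T 1) {0..T 1}"
        using has_integral_const_real[of l0 0 "T 1"] T_pos[of 1] Suc.prems
        by (simp add: True mult.commute)
    qed (use Suc.prems True intensity_before_first in auto)
    then show ?thesis using True by simp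
  next
    case False
    then have m: "m \<in> {1..n}" "m < n" using Suc.prems by auto
    then have T: "0 \<le> T m" "T m \<le> T (Suc m)"
      using T_pos[of m] T_less_iff[of m "Suc m"] by auto
    have pos: "0 < relax m (T (Suc m))" using Suc.prems(2)[of m] m by auto
    note after = has_integral_intensity_after[OF m(1) T(2)]
    have "(lam has_integral compensator_term n T l0 a b (Suc m)) {T m..T (Suc m)}"
      using after pos m by (simp add: compensator_term_def)
    moreover have "(lam has_integral l0 * T 1 + (\<Sum>k=2..m. compensator_term n T l0 a b k)) {0..T m}"
      using Suc.IH Suc.prems m by auto
    ultimately have "(lam has_integral l0 * T 1 + (\<Sum>k=2..m. compensator_term n T l0 a b k)
        + compensator_term n T l0 a b (Suc m)) {0..T (Suc m)}"
      using T by (blast intro: has_integral_combine)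
    then show ?thesis using m by (simp add: algebra_simps)
  qed
qed

lemma compensator_closed_form:
  assumes "n \<ge> 1" "T n \<le> t" "\<And>k. k \<in> {1..<n} \<Longrightarrow> 0 < relax k (T (Suc k))"
  shows "compensator n T l0 a b t =
    l0 * T 1 + (\<Sum>k=2..n. compensator_term n T l0 a b k)
    + (l0 * (t - restart n) + inverse b * (ustar (T n) - l0)
        * (exp (- b * (restart n - T n)) - exp (- b * (t - T n)))) * indicator {restart n<..} t"
  unfolding compensator_def
proof (rule integral_unique, rule has_integral_combine[of 0 "T n" t])
  show "0 \<le> T n" using T_pos[of n] assms(1) by auto
  show "T n \<le> t" by (rule assms(2))
  show "(lam has_integral l0 * T 1 + (\<Sum>k=2..n. compensator_term n T l0 a b k)) {0..T n}"
    by (rule has_integral_intensity_upto_event) (use assms in auto)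
qed (rule has_integral_intensity_after(1), use assms in auto)

section \<open>The log-likelihood\<close>

lemma sum_elog_left_limits:
  assumes "n \<ge> 1"
  shows "(\<Sum>k=1..n. elog (Lim (at_left (T k)) lam))
    = elog l0 + (\<Sum>k=2..n. elog (relax (k - 1) (T k)))"
proof -
  have "elog (Lim (at_left (T k)) lam) = elog (relax (k - 1) (T k))" if "k \<in> {2..n}" for k
  proof -
    have "k - 1 \<in> {1..<n}" "Suc (k - 1) = k" using that by auto
    then show ?thesis using left_limit_next[of "k - 1"] by (simp add: elog_max_0)
  qed
  moreover have "(\<Sum>k=1..n. elog (Lim (at_left (T k)) lam))
      = elog l0 + (\<Sum>k=2..n. elog (Lim (at_left (T k)) lam))"
    using assms left_limit_first by (simp add: sum.atLeast_Suc_atMost numeral_2_eq_2)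
  ultimately show ?thesis by simp
qed

end

theorem corollary3p1:
  fixes t l0 a b :: real and n :: nat and T :: "nat \<Rightarrow> real"
  assumes "t > 0"
    and "n \<ge> 1"
    and "strict_mono_on {1..n} T"
    and "\<And>k. k \<in> {1..n} \<Longrightarrow> 0 < T k \<and> T k \<le> t"
    and "(l0, a, b) \<in> hawkes_params"
  shows "log_likelihood n T l0 a b t =
    elog l0 - ereal (l0 * T 1)
    + (\<Sum>k=2..n.
         elog (l0 + (underlying_intensity n T l0 a b (T (k - 1)) - l0) * exp (- b * (T k - T (k - 1))))
         - ereal (compensator_term n T l0 a b k))
    - ereal ((l0 * (t - restart_time n T l0 a b n)
              + inverse b * (underlying_intensity n T l0 a b (T n) - l0)
                * (exp (- b * (restart_time n T l0 a b n - T n)) - exp (- b * (t - T n))))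
             * indicator {restart_time n T l0 a b n<..} t)"
proof -
  interpret hawkes_sample n T l0 a b
    using assms(3-5) by unfold_locales (auto simp: hawkes_params_def)
  let ?x = "\<lambda>k. relax (k - 1) (T k)"
  let ?c = "compensator_term n T l0 a b"
  define last_term where "last_term =
    (l0 * (t - restart n) + inverse b * (ustar (T n) - l0)
      * (exp (- b * (restart n - T n)) - exp (- b * (t - T n)))) * indicator {restart n<..} t"
  have l0: "elog l0 = ereal (ln l0)"
    using l0_pos by (simp add: elog_def)
  have "(\<Sum>k=1..n. elog (Lim (at_left (T k)) lam)) - ereal (compensator n T l0 a b t)
      = elog l0 - ereal (l0 * T 1) + (\<Sum>k=2..n. elog (?x k) - ereal (?c k)) - ereal last_term"
    unfolding sum_elog_left_limits[OF assms(2)]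
  proof (cases "\<forall>k\<in>{2..n}. 0 < ?x k")
    case True
    then have pos: "0 < relax k (T (Suc k))" if "k \<in> {1..<n}" for k
      using that by (auto dest: bspec[of _ _ "Suc k"])
    have comp: "compensator n T l0 a b t = l0 * T 1 + (\<Sum>k=2..n. ?c k) + last_term"
      unfolding last_term_def using assms(2,4) pos by (intro compensator_closed_form) auto
    have log: "elog (?x k) = ereal (ln (?x k))" if "k \<in> {2..n}" for k
      using True that by (force simp: elog_def)
    have "(\<Sum>k=2..n. elog (?x k)) = ereal (\<Sum>k=2..n. ln (?x k))"
      using log by simp
    moreover have "(\<Sum>k=2..n. elog (?x k) - ereal (?c k)) = ereal (\<Sum>k=2..n. ln (?x k) - ?c k)"
      using log by simp
    ultimately show "elog l0 + (\<Sum>k=2..n. elog (?x k)) - ereal (compensator n T l0 a b t)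
      = elog l0 - ereal (l0 * T 1) + (\<Sum>k=2..n. elog (?x k) - ereal (?c k)) - ereal last_term"
      by (simp add: comp l0 sum_subtractf)
  next
    case False
    then obtain k where k: "k \<in> {2..n}" "elog (?x k) = -\<infinity>"
      by (auto simp: elog_def not_less)
    have "(\<Sum>k=2..n. elog (?x k)) = -\<infinity>"
      by (rule sum_ereal_MInf[where i = k]) (use k in auto)
    moreover have "(\<Sum>k=2..n. elog (?x k) - ereal (?c k)) = -\<infinity>"
      by (rule sum_ereal_MInf[where i = k]) (use k in \<open>auto simp: elog_def\<close>)
    ultimately show "elog l0 + (\<Sum>k=2..n. elog (?x k)) - ereal (compensator n T l0 a b t)
      = elog l0 - ereal (l0 * T 1) + (\<Sum>k=2..n. elog (?x k) - ereal (?c k)) - ereal last_term"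
      by (simp add: l0)
  qed
  then show ?thesis
    by (simp add: log_likelihood_def relax_def last_term_def)
qed

end
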